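(* There exists a constant $\rho>0$ such that for all sufficiently large $n$ and any integer $m\ge\rho^{-1}\cdot n\log n$, the Mean-Thinning process on $n$ bins satisfies $$\mathbb{E}[\eta^m]\ge \tfrac12+\rho\qquad\text{and}\qquad \Pr\big[\eta^m\ge \tfrac12+\rho\big]\ge 1-n^{-1/4}.$$
   Context: The Mean-Thinning process on $n$ bins starts with the empty load vector $x^0=(0,\dots,0)$. In each round $t\ge0$, a first bin $i_1\in[n]$ is sampled uniformly at random. If $x_{i_1}^t<t/n$, one ball is allocated to $i_1$ (and no second sample is taken); if $x_{i_1}^t\ge t/n$, a second bin $i_2\in[n]$ is sampled uniformly and independently and one ball is allocated to $i_2$. The sample efficiency is $\eta^m=W^m/S^m$, where $W^m$ is the total number of balls allocated in the first $m$ rounds (here $W^m=m$) and $S^m$ is the total number of uniform bin samples taken in the first $m$ rounds (a round uses one sample if the first sample is accepted and two otherwise). *)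

theory Defs
  imports "HOL-Probability.Probability"
begin

text \<open>
  A state is a pair \<open>(x, s)\<close>: the load vector \<open>x\<close>, with bins \<open>{1..n}\<close>, and the number \<open>s\<close> of
  uniform bin samples taken so far. The distribution \<open>pmf_of_set {1..n}\<close> is meaningful only
  for \<open>n > 0\<close>.
\<close>

type_synonym state = "(nat \<Rightarrow> nat) \<times> nat"

definition mean_thinning_step :: "nat \<Rightarrow> nat \<Rightarrow> state \<Rightarrow> state pmf" where
  "mean_thinning_step n t = (\<lambda>(x, s).
     do {
       i1 \<leftarrow> pmf_of_set {1..n};
       if real (x i1) < real t / real n
       then return_pmf (x(i1 := x i1 + 1), s + 1)
       else do {
         i2 \<leftarrow> pmf_of_set {1..n};
         return_pmf (x(i2 := x i2 + 1), s + 2)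
       }
     })"

text \<open>The law of the state after the first \<open>m\<close> rounds, which are numbered \<open>0, \<dots>, m - 1\<close>.\<close>

primrec mean_thinning :: "nat \<Rightarrow> nat \<Rightarrow> state pmf" where
  "mean_thinning n 0 = return_pmf (\<lambda>_. 0, 0)"
| "mean_thinning n (Suc t) = bind_pmf (mean_thinning n t) (mean_thinning_step n t)"

text \<open>The total number of allocated balls is the sum of the loads.\<close>

definition sample_efficiency :: "nat \<Rightarrow> state \<Rightarrow> real" where
  "sample_efficiency n = (\<lambda>(x, s). real (\<Sum>i\<in>{1..n}. x i) / real s)"

end

theory Submission
  imports Defs "HOL-Real_Asymp.Real_Asymp"
begin

text \<open>
  Let \<open>y i\<close> be the deviation of bin \<open>i\<close> from the mean load, let \<open>u\<close> be the fraction of bins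
  with \<open>y i < 0\<close>, and let \<open>v\<close> be \<open>1/n\<close> times the (negative) sum of these \<open>y i\<close>. Acceptances
  occur at rate \<open>u\<close>. The sum of the \<open>(y i)\<^sup>2\<close> drifts by at most \<open>1 + 2 v\<close>. The sum of the
  \<open>exp (- y i)\<close>, suitably capped, drifts by at least \<open>1/4 - 25/4 u + v/4\<close>: the overloaded bins
  contribute positively by convexity, and \<open>exp (- y) \<ge> 1 - y\<close> while the overloaded \<open>y i\<close> have sum
  \<open>- n v\<close>. Subtracting \<open>1/8\<close> of the first from the second cancels \<open>v\<close>, so with the number \<open>A\<close> of
  acceptances added seven times and \<open>t/8\<close> subtracted one gets a submartingale. Its positive part
  beyond \<open>7 A - t/8\<close> is at most \<open>3 n\<close>, hence \<open>A\<close> is linear in \<open>m\<close> unless the submartingale is very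
  negative. A second moment estimate makes this unlikely: a step changes it by
  \<open>O(1 + \<bar>y j\<bar>)\<close>, where \<open>j\<close> is the bin receiving the ball, and the expected sum of squares is at
  most \<open>t\<close>, so the failure probability is \<open>O(1/n)\<close>.
\<close>

section \<open>Deviations, potentials and the law of the receiving bin\<close>

definition dev :: "nat \<Rightarrow> nat \<Rightarrow> (nat \<Rightarrow> nat) \<Rightarrow> nat \<Rightarrow> real" where
  "dev n t x i = real (x i) - real t / real n"

definition underloaded :: "nat \<Rightarrow> nat \<Rightarrow> (nat \<Rightarrow> nat) \<Rightarrow> nat set" where
  "underloaded n t x = {i \<in> {1..n}. real (x i) < real t / real n}"

definition allocate :: "(nat \<Rightarrow> nat) \<Rightarrow> nat \<Rightarrow> nat \<Rightarrow> nat" where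
  "allocate x j = x(j := x j + 1)"

definition potential :: "(real \<Rightarrow> real) \<Rightarrow> nat \<Rightarrow> nat \<Rightarrow> (nat \<Rightarrow> nat) \<Rightarrow> real" where
  "potential f n t x = (\<Sum>i\<in>{1..n}. f (dev n t x i))"

text \<open>\<open>weight n t x j / n\<close> is the probability that the next ball goes to bin \<open>j\<close>.\<close>

definition weight :: "nat \<Rightarrow> nat \<Rightarrow> (nat \<Rightarrow> nat) \<Rightarrow> nat \<Rightarrow> real" where
  "weight n t x j =
     (if j \<in> underloaded n t x then 1 else 0) + (1 - real (card (underloaded n t x)) / real n)"

lemma finite_underloaded [simp]: "finite (underloaded n t x)"
  by (simp add: underloaded_def)

lemma underloaded_subset: "underloaded n t x \<subseteq> {1..n}"
  by (auto simp: underloaded_def)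

lemma sum_underloaded:
  "(\<Sum>j\<in>{1..n}. if j \<in> underloaded n t x then f j else 0) = (\<Sum>j\<in>underloaded n t x. f j)"
  for f :: "nat \<Rightarrow> real"
  using underloaded_subset[of n t x]
  by (subst sum.inter_restrict[symmetric]) (auto simp: Int_absorb1)

lemma card_underloaded_le: "card (underloaded n t x) \<le> n"
  using card_mono[OF _ underloaded_subset[of n t x]] by simp

lemma weight_bounds:
  assumes "n > 0"
  shows "0 \<le> weight n t x j" "weight n t x j \<le> 2"
    and "j \<notin> underloaded n t x \<Longrightarrow> weight n t x j \<le> 1"
  using card_underloaded_le[of n t x] assms by (auto simp: weight_def field_simps)

lemma sum_weight: "n > 0 \<Longrightarrow> (\<Sum>j\<in>{1..n}. weight n t x j) = real n"
  unfolding weight_def sum.distrib sum_underloaded by (simp add: field_simps)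

section \<open>Law of one round, and invariants of the process\<close>

lemma finite_set_step: "n > 0 \<Longrightarrow> finite (set_pmf (mean_thinning_step n t \<omega>))"
  by (cases \<omega>) (auto simp: mean_thinning_step_def)

text \<open>After a rejection the second sample is independent of the first, so every rejected
  \<open>i1\<close> contributes the same uniform average. The two summands stay separate because
  \<open>F\<close> also sees the sample count.\<close>

lemma expectation_step:
  fixes F :: "state \<Rightarrow> real"
  assumes n: "n > 0"
  shows "measure_pmf.expectation (mean_thinning_step n t (x, s)) F =
    (\<Sum>j\<in>{1..n}. (if j \<in> underloaded n t x then F (allocate x j, s + 1) else 0)
       + (1 - real (card (underloaded n t x)) / real n) * F (allocate x j, s + 2)) / real n"
proof -
  let ?U = "underloaded n t x"
  let ?R = "(\<Sum>j\<in>{1..n}. F (allocate x j, s + 2)) / real n"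
  have "measure_pmf.expectation (mean_thinning_step n t (x, s)) F =
    (\<Sum>i\<in>{1..n}. if i \<in> ?U then F (allocate x i, s + 1) else ?R) / real n"
    unfolding mean_thinning_step_def prod.case using n
    by (subst pmf_expectation_bind_pmf_of_set)
       (auto intro!: sum.cong
             simp: underloaded_def allocate_def pmf_expectation_bind_pmf_of_set
                   divide_inverse mult.commute sum_distrib_left)
  also have "(\<Sum>i\<in>{1..n}. if i \<in> ?U then F (allocate x i, s + 1) else ?R) =
     (\<Sum>i\<in>{1..n}. (if i \<in> ?U then F (allocate x i, s + 1) else 0) + (?R - (if i \<in> ?U then ?R else 0)))"
    by (intro sum.cong) auto
  also have "\<dots> = (\<Sum>i\<in>{1..n}. if i \<in> ?U then F (allocate x i, s + 1) else 0)
      + (real n * ?R - real (card ?U) * ?R)"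
    unfolding sum.distrib sum_subtractf sum_underloaded by simp
  also have "real n * ?R - real (card ?U) * ?R = (1 - real (card ?U) / real n) * (real n * ?R)"
    using n by (simp add: field_simps)
  also have "\<dots> = (\<Sum>j\<in>{1..n}. (1 - real (card ?U) / real n) * F (allocate x j, s + 2))"
    unfolding sum_distrib_left[symmetric] using n by simp
  finally show ?thesis by (simp add: sum.distrib)
qed

lemma set_stepD:
  assumes "(x', s') \<in> set_pmf (mean_thinning_step n t (x, s))" "n > 0"
  obtains j where "j \<in> {1..n}" "x' = allocate x j" "s' = s + 1 \<or> s' = s + 2"
  using assms by (auto simp: mean_thinning_step_def allocate_def split: if_splits)

lemma finite_set_mean_thinning: "n > 0 \<Longrightarrow> finite (set_pmf (mean_thinning n t))"
  by (induction t) (auto simp: finite_set_step)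

lemma integrable_step [intro, simp]:
  "n > 0 \<Longrightarrow> integrable (mean_thinning_step n t \<omega>) (f :: state \<Rightarrow> real)"
  by (intro integrable_measure_pmf_finite finite_set_step)

lemma integrable_mean_thinning [intro, simp]:
  "n > 0 \<Longrightarrow> integrable (mean_thinning n t) (f :: state \<Rightarrow> real)"
  by (intro integrable_measure_pmf_finite finite_set_mean_thinning)

lemma sum_allocate: "j \<in> {1..n} \<Longrightarrow> (\<Sum>i\<in>{1..n}. allocate x j i) = Suc (\<Sum>i\<in>{1..n}. x i)"
proof -
  assume j: "j \<in> {1..n}"
  have "(\<Sum>i\<in>{1..n}. allocate x j i) = (\<Sum>i\<in>{1..n}. x i + (if i = j then 1 else 0))"
    by (intro sum.cong) (auto simp: allocate_def)
  with j show ?thesis by (simp add: sum.distrib)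
qed

lemma mean_thinning_invariant:
  assumes "(x, s) \<in> set_pmf (mean_thinning n t)" "n > 0"
  shows "(\<Sum>i\<in>{1..n}. x i) = t \<and> t \<le> s \<and> s \<le> 2 * t"
  using assms
proof (induction t arbitrary: x s)
  case (Suc t)
  then obtain x0 s0 where *: "(x0, s0) \<in> set_pmf (mean_thinning n t)"
    "(x, s) \<in> set_pmf (mean_thinning_step n t (x0, s0))" by auto
  obtain j where j: "j \<in> {1..n}" "x = allocate x0 j" "s = s0 + 1 \<or> s = s0 + 2"
    using set_stepD[OF *(2) Suc.prems(2)] by blast
  then show ?case using Suc.IH[OF *(1) Suc.prems(2)] sum_allocate[OF j(1), of x0] by auto
qed auto

lemma expectation_mean_thinning_Suc:
  fixes F :: "state \<Rightarrow> real"
  assumes "n > 0"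
  shows "measure_pmf.expectation (mean_thinning n (Suc t)) F =
    measure_pmf.expectation (mean_thinning n t)
      (\<lambda>\<omega>. measure_pmf.expectation (mean_thinning_step n t \<omega>) F)"
  using finite_set_mean_thinning[OF assms, of t] finite_set_step[OF assms]
  by (simp add: pmf_expectation_bind[of "set_pmf (mean_thinning n t)"]
      integral_measure_pmf[of "set_pmf (mean_thinning n t)"])

section \<open>One-step drift of a potential\<close>

lemma sum_dev:
  assumes "(\<Sum>i\<in>{1..n}. x i) = t" "n > 0"
  shows "(\<Sum>i\<in>{1..n}. dev n t x i) = 0"
  using assms by (simp add: dev_def sum_subtractf flip: of_nat_sum)

text \<open>The part of the weight common to all bins cancels because the deviations sum to zero;
  only acceptances remain.\<close>

lemma sum_weight_dev:
  assumes "(\<Sum>i\<in>{1..n}. x i) = t" "n > 0"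
  shows "(\<Sum>i\<in>{1..n}. weight n t x i * dev n t x i) = (\<Sum>i\<in>underloaded n t x. dev n t x i)"
proof -
  have "(\<Sum>i\<in>{1..n}. weight n t x i * dev n t x i) =
     (\<Sum>i\<in>{1..n}. (if i \<in> underloaded n t x then dev n t x i else 0)
       + (1 - real (card (underloaded n t x)) / real n) * dev n t x i)"
    by (intro sum.cong) (auto simp: weight_def algebra_simps)
  then show ?thesis
    unfolding sum.distrib sum_distrib_left[symmetric] sum_dev[OF assms] sum_underloaded by simp
qed

text \<open>The mean load rises by \<open>1 / n\<close>, which lowers every deviation by
  \<open>1 / n\<close>; the receiving bin then moves up by 1.\<close>

lemma potential_allocate:
  assumes "j \<in> {1..n}" "n > 0"
  shows "potential f n (Suc t) (allocate x j) = potential f n t x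
    + (\<Sum>i\<in>{1..n}. f (dev n t x i - 1 / n) - f (dev n t x i))
    + (f (dev n t x j + 1 - 1 / n) - f (dev n t x j - 1 / n))"
proof -
  have d: "dev n (Suc t) (allocate x j) i =
      (if i = j then dev n t x i + 1 - 1 / n else dev n t x i - 1 / n)" for i
    using assms(2) by (auto simp: dev_def allocate_def field_simps)
  have "potential f n (Suc t) (allocate x j) = (\<Sum>i\<in>{1..n}. f (dev n t x i - 1 / n)
     + (if i = j then f (dev n t x j + 1 - 1 / n) - f (dev n t x j - 1 / n) else 0))"
    unfolding potential_def d by (intro sum.cong) auto
  then show ?thesis using assms(1) by (simp add: sum.distrib sum_subtractf potential_def)
qed

text \<open>This is the expected one-round change of \<open>potential f\<close>, arranged as a sum
  over bins so that it can be bounded bin by bin.\<close>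

definition drift :: "(real \<Rightarrow> real) \<Rightarrow> nat \<Rightarrow> nat \<Rightarrow> (nat \<Rightarrow> nat) \<Rightarrow> real" where
  "drift f n t x = (\<Sum>i\<in>{1..n}. f (dev n t x i - 1 / n) - f (dev n t x i)
    + weight n t x i * (f (dev n t x i + 1 - 1 / n) - f (dev n t x i - 1 / n)) / n)"

text \<open>A first sample is accepted with probability u, so a round costs 2 - u samples on
  average. The multiple \<open>c\<close> serves two uses: 0 for the squares and 7 for the
  surplus.\<close>

lemma expectation_step_potential:
  assumes n: "n > 0"
  shows "measure_pmf.expectation (mean_thinning_step n t (x, s))
      (\<lambda>(x', s'). potential f n (Suc t) x' - c * real s') =
    potential f n t x - c * real s + drift f n t x
      - c * (2 - real (card (underloaded n t x)) / real n)"
    (is "?L = ?R")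
proof -
  let ?u = "real (card (underloaded n t x)) / real n"
  let ?B = "potential f n t x - c * real s
     + (\<Sum>i\<in>{1..n}. f (dev n t x i - 1 / n) - f (dev n t x i)) - 2 * c"
  let ?d = "\<lambda>j. f (dev n t x j + 1 - 1 / n) - f (dev n t x j - 1 / n)"
  have "?L = (\<Sum>j\<in>{1..n}. weight n t x j * (?B + ?d j)
      + (if j \<in> underloaded n t x then c else 0)) / n"
    unfolding expectation_step[OF n] prod.case
    by (intro arg_cong[where f = "\<lambda>z. z / real n"] sum.cong)
       (auto simp: potential_allocate[OF _ n] weight_def algebra_simps)
  also have "\<dots> = (real n * ?B + (\<Sum>j\<in>{1..n}. weight n t x j * ?d j)
      + real (card (underloaded n t x)) * c) / n"
    unfolding sum.distrib distrib_left sum_distrib_right[symmetric] sum_weight[OF n]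
      sum_underloaded by simp
  also have "\<dots> = ?B + (\<Sum>j\<in>{1..n}. weight n t x j * ?d j / n) + ?u * c"
    unfolding sum_divide_distrib[symmetric] using n by (simp add: add_divide_distrib)
  also have "\<dots> = ?R"
    unfolding drift_def sum.distrib by (simp add: algebra_simps)
  finally show ?thesis .
qed

lemma drift_square:
  assumes "(\<Sum>i\<in>{1..n}. x i) = t" and n: "n > 0"
  shows "drift (\<lambda>y. y\<^sup>2) n t x = 1 - 1 / n + 2 / n * (\<Sum>i\<in>underloaded n t x. dev n t x i)"
proof -
  have "drift (\<lambda>y. y\<^sup>2) n t x = (\<Sum>i\<in>{1..n}. (- 2 / n) * dev n t x i + 1 / n ^ 2
      + 2 / n * (weight n t x i * dev n t x i) + (1 - 2 / n) / n * weight n t x i)"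
    unfolding drift_def
    by (intro sum.cong) (auto simp: algebra_simps power2_eq_square add_divide_distrib diff_divide_distrib)
  also have "\<dots> = 1 / n + 2 / n * (\<Sum>i\<in>underloaded n t x. dev n t x i) + (1 - 2 / n)"
    unfolding sum.distrib sum_distrib_left[symmetric] sum_weight_dev[OF assms] sum_weight[OF n]
      sum_dev[OF assms] using n by (simp add: power2_eq_square)
  finally show ?thesis by simp
qed


section \<open>Second moment of the deviations\<close>

lemma expectation_mean_thinning_Suc_le:
  fixes F G :: "state \<Rightarrow> real"
  assumes n: "n > 0"
    and le: "\<And>\<omega>. \<omega> \<in> set_pmf (mean_thinning n t) \<Longrightarrow>
      measure_pmf.expectation (mean_thinning_step n t \<omega>) F \<le> G \<omega>"
  shows "measure_pmf.expectation (mean_thinning n (Suc t)) F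
    \<le> measure_pmf.expectation (mean_thinning n t) G"
  unfolding expectation_mean_thinning_Suc[OF n]
  by (intro integral_mono_AE integrable_mean_thinning n) (simp add: AE_measure_pmf_iff le)

text \<open>A bound that ignores whether one or two samples were taken merges both ways of reaching
  bin \<open>j\<close> into its weight.\<close>

lemma expectation_step_le:
  fixes F :: "state \<Rightarrow> real"
  assumes n: "n > 0"
    and "\<And>j. j \<in> {1..n} \<Longrightarrow> F (allocate x j, s + 1) \<le> b j"
    and "\<And>j. j \<in> {1..n} \<Longrightarrow> F (allocate x j, s + 2) \<le> b j"
  shows "measure_pmf.expectation (mean_thinning_step n t (x, s)) F
    \<le> (\<Sum>j\<in>{1..n}. weight n t x j * b j) / n"
  unfolding expectation_step[OF n]
proof (intro divide_right_mono sum_mono)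
  let ?v = "1 - real (card (underloaded n t x)) / real n"
  fix j assume j: "j \<in> {1..n}"
  have "?v \<ge> 0" using card_underloaded_le[of n t x] n by (simp add: field_simps)
  then have "?v * F (allocate x j, s + 2) \<le> ?v * b j"
    using assms(3)[OF j] by (rule mult_left_mono[rotated])
  then show "(if j \<in> underloaded n t x then F (allocate x j, s + 1) else 0)
      + ?v * F (allocate x j, s + 2) \<le> weight n t x j * b j"
    using assms(2)[OF j] by (auto simp: weight_def distrib_right)
qed simp

text \<open>The underloaded deviations have nonpositive sum, so by \<open>drift_square\<close> each
  round adds at most 1.\<close>

lemma expectation_square_potential_le:
  assumes n: "n > 0"
  shows "measure_pmf.expectation (mean_thinning n t) (\<lambda>(x, s). potential (\<lambda>y. y\<^sup>2) n t x) \<le> t"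
proof (induction t)
  case 0
  show ?case by (simp add: potential_def dev_def)
next
  case (Suc t)
  have "measure_pmf.expectation (mean_thinning n (Suc t))
      (\<lambda>(x, s). potential (\<lambda>y. y\<^sup>2) n (Suc t) x)
    \<le> measure_pmf.expectation (mean_thinning n t) (\<lambda>\<omega>. (case \<omega> of (x, s) \<Rightarrow> potential (\<lambda>y. y\<^sup>2) n t x) + 1)"
  proof (rule expectation_mean_thinning_Suc_le[OF n])
    fix \<omega> assume \<omega>: "\<omega> \<in> set_pmf (mean_thinning n t)"
    obtain x s where [simp]: "\<omega> = (x, s)" by fastforce
    have "(\<Sum>i\<in>underloaded n t x. dev n t x i) \<le> 0"
      by (intro sum_nonpos) (auto simp: underloaded_def dev_def)
    then have "2 / n * (\<Sum>i\<in>underloaded n t x. dev n t x i) \<le> 0"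
      using n by (simp add: mult_nonneg_nonpos divide_le_0_iff)
    moreover have "drift (\<lambda>y. y\<^sup>2) n t x = 1 - 1 / n + 2 / n * (\<Sum>i\<in>underloaded n t x. dev n t x i)"
      using mean_thinning_invariant[of x s n t] \<omega> n by (intro drift_square) auto
    moreover have "1 / real n \<ge> 0" by simp
    ultimately have "drift (\<lambda>y. y\<^sup>2) n t x \<le> 1" by linarith
    then show "measure_pmf.expectation (mean_thinning_step n t \<omega>)
        (\<lambda>(x, s). potential (\<lambda>y. y\<^sup>2) n (Suc t) x)
      \<le> (case \<omega> of (x, s) \<Rightarrow> potential (\<lambda>y. y\<^sup>2) n t x) + 1"
      using expectation_step_potential[OF n, of t x s "\<lambda>y. y\<^sup>2" 0] by simp
  qed
  also have "\<dots> = measure_pmf.expectation (mean_thinning n t) (\<lambda>(x, s). potential (\<lambda>y. y\<^sup>2) n t x) + 1"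
    by (simp add: n del: mean_thinning.simps)
  finally show ?case using Suc.IH by simp
qed

section \<open>Drift of the capped exponential and of the bin energy\<close>

text \<open>
  The cap is at \<open>- 1 / n\<close> rather than at 0, so that a bin with deviation exactly 0 that receives
  no ball still moves along the exponential.
\<close>

definition capped_exp :: "nat \<Rightarrow> real \<Rightarrow> real" where
  "capped_exp n y = exp (- max y (- 1 / n))"

definition bin_energy :: "nat \<Rightarrow> real \<Rightarrow> real" where
  "bin_energy n y = capped_exp n y - y\<^sup>2 / 8"

lemma exp_1_less_3: "exp (1::real) < 3"
  using e_less_272 by simp

lemma capped_exp_bounds:
  assumes "n > 0"
  shows "0 < capped_exp n y" "capped_exp n y \<le> 3"
proof -
  have "- 1 \<le> - 1 / real n" using assms by (simp add: field_simps)
  then have "- max y (- 1 / n) \<le> (1::real)" by (simp add: max.coboundedI2)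
  then have "capped_exp n y \<le> exp 1" by (simp add: capped_exp_def)
  then show "capped_exp n y \<le> 3" using exp_1_less_3 by simp
qed (simp add: capped_exp_def)

lemma capped_exp_antimono: "a \<le> b \<Longrightarrow> capped_exp n b \<le> capped_exp n a"
  by (auto simp: capped_exp_def)

text \<open>The cap keeps the values, and hence the slope of the exponential, below 3, and
  \<open>max\<close> with a constant does not expand distances.\<close>

lemma capped_exp_lipschitz:
  assumes "n > 0"
  shows "\<bar>capped_exp n a - capped_exp n b\<bar> \<le> 3 * \<bar>a - b\<bar>"
proof (induction a b rule: linorder_wlog)
  case (le a b)
  let ?m = "\<lambda>y. max y (- 1 / real n)"
  have "1 - exp (- (?m b - ?m a)) \<le> ?m b - ?m a"
    using exp_ge_add_one_self[of "- (?m b - ?m a)"] by linarith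
  also have "\<dots> \<le> b - a" using le by (auto simp: max_def)
  finally have "capped_exp n a * (1 - exp (- (?m b - ?m a))) \<le> 3 * (b - a)"
    using capped_exp_bounds[OF assms, of a] le by (intro mult_mono) auto
  moreover have "capped_exp n a * (1 - exp (- (?m b - ?m a))) = capped_exp n a - capped_exp n b"
    by (simp add: capped_exp_def right_diff_distrib flip: exp_add)
  ultimately show ?case using capped_exp_antimono[OF le, of n] le by simp
qed (simp add: abs_minus_commute)

lemma exp_minus_1_ge: "exp (-1::real) \<ge> 1 / 3"
  using exp_1_less_3 by (simp add: exp_minus field_simps)

lemma drift_capped_exp:
  assumes "(\<Sum>i\<in>{1..n}. x i) = t" and n: "n \<ge> 8"
  shows "drift (capped_exp n) n t x \<ge> 1 / 4 - 25 / 4 * (real (card (underloaded n t x)) / real n)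
    + (\<Sum>i\<in>underloaded n t x. dev n t x i) / (4 * n)"
proof -
  let ?U = "underloaded n t x"
  let ?y = "dev n t x"
  \<comment> \<open>The term \<open>- ?y i / (4 * n)\<close> sums to zero over all bins. On
    underloaded bins the correction removes it and leaves -6/n (1/4 - 25/4 = -6), the worst loss for
    weight at most 2 and a drop of at most 3.\<close>
  let ?lower = "\<lambda>i. 1 / (4 * n) - ?y i / (4 * n)
      + (if i \<in> ?U then - (25 / 4) / n + ?y i / (4 * n) else 0)"
  have n0: "n > 0" using n by simp
  have "(\<Sum>i\<in>{1..n}. ?lower i) \<le> drift (capped_exp n) n t x"
    unfolding drift_def
  proof (intro sum_mono)
    fix i assume i: "i \<in> {1..n}"
    let ?w = "weight n t x i"
    let ?D = "capped_exp n (?y i + 1 - 1 / n) - capped_exp n (?y i - 1 / n)"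
    show "?lower i \<le> capped_exp n (?y i - 1 / n) - capped_exp n (?y i) + ?w * ?D / n"
    proof (cases "i \<in> ?U")
      case True
      have "?D \<ge> - 3"
        using capped_exp_bounds[OF n0, of "?y i - 1 / n"] capped_exp_bounds[OF n0, of "?y i + 1 - 1 / n"]
        by simp
      then have "?w * ?D \<ge> ?w * (- 3)" using weight_bounds(1)[OF n0] by (rule mult_left_mono)
      then have "?w * ?D \<ge> - 6" using weight_bounds(2)[OF n0, of t x i] by simp
      then have "?w * ?D / n \<ge> - 6 / n" by (intro divide_right_mono) auto
      moreover have "capped_exp n (?y i - 1 / n) \<ge> capped_exp n (?y i)"
        by (intro capped_exp_antimono) simp
      moreover have "?lower i = - 6 / n" using True n0 by (simp add: field_simps)
      ultimately show ?thesis by linarith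
    next
      case False
      have y: "?y i \<ge> 0" using False i by (simp add: underloaded_def dev_def)
      have "- 1 / real n = - (1 / real n)" "1 / real n \<ge> 0" by simp_all
      with y have le: "- 1 / real n \<le> ?y i" "- 1 / real n \<le> ?y i - 1 / real n"
        "- 1 / real n \<le> ?y i + 1 - 1 / real n"
        by linarith+
      note mx = le[THEN max_absorb1]
      have w: "0 \<le> ?w" "?w \<le> 1" using weight_bounds[OF n0] False by auto
      \<comment> \<open>All three arguments lie above the cap, so \<open>exp (- ?y i)\<close>
        factors out and \<open>q\<close> is the relative drift. It is positive because a bin that is
        not underloaded has weight at most 1 and 1 - 1/e is at most 2/3.\<close>
      define q where "q = exp (1 / real n) * (1 - ?w / n * (1 - exp (-1))) - 1"
      have "capped_exp n (?y i - 1 / n) = exp (- ?y i) * exp (1 / n)"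
        "capped_exp n (?y i + 1 - 1 / n) = exp (- ?y i) * exp (1 / n) * exp (-1)"
        "capped_exp n (?y i) = exp (- ?y i)"
        unfolding capped_exp_def mx exp_add[symmetric] by simp_all
      then have eq: "capped_exp n (?y i - 1 / n) - capped_exp n (?y i) + ?w * ?D / n = exp (- ?y i) * q"
        using n0 by (simp add: q_def field_simps)
      have "?w * (1 - exp (-1)) \<le> 1 * (2 / 3)"
        using w exp_minus_1_ge by (intro mult_mono) auto
      then have "?w / n * (1 - exp (-1)) \<le> 2 / 3 / n"
        using divide_right_mono[of "?w * (1 - exp (-1))" "2 / 3" "real n"] by simp
      then have "(1 + 1 / n) * (1 - 2 / 3 / n) \<le> exp (1 / n) * (1 - ?w / n * (1 - exp (-1)))"
        using n exp_ge_add_one_self[of "1 / real n"] by (intro mult_mono) (auto simp: field_simps)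
      \<comment> \<open>The product is 1 + 1/(3n) - 2/(3n^2); it reaches 1 + 1/(4n) exactly when n
        is at least 8.\<close>
      moreover have "(1 + 1 / n) * (1 - 2 / 3 / n) \<ge> 1 + 1 / (4 * real n)"
        using n by (simp add: field_simps)
      ultimately have q: "q \<ge> 1 / (4 * n)" unfolding q_def by linarith
      have "(1 - ?y i) * (1 / (4 * n)) \<le> exp (- ?y i) * (1 / (4 * n))"
        using exp_ge_add_one_self[of "- ?y i"] by (intro mult_right_mono) auto
      also have "\<dots> \<le> exp (- ?y i) * q" using q by (intro mult_left_mono) auto
      finally show ?thesis unfolding eq using False by (simp add: diff_divide_distrib)
    qed
  qed
  moreover have "(\<Sum>i\<in>{1..n}. ?lower i) = 1 / 4 - 25 / 4 * (real (card ?U) / real n)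
    + (\<Sum>i\<in>?U. ?y i) / (4 * n)"
    unfolding sum.distrib sum_subtractf sum_underloaded sum_divide_distrib[symmetric] sum_dev[OF assms(1) n0]
    using n0 by simp
  ultimately show ?thesis by simp
qed

text \<open>The terms v/4 and 2v/8 cancel, 1/4 - 1/8 leaves 1/8, and 25/4 is rounded up to 7 using u
  \<ge> 0.\<close>

lemma drift_bin_energy:
  assumes "(\<Sum>i\<in>{1..n}. x i) = t" and n: "n \<ge> 8"
  shows "drift (bin_energy n) n t x \<ge> 1 / 8 - 7 * (real (card (underloaded n t x)) / real n)"
proof -
  have n0: "n > 0" using n by simp
  define u where "u = real (card (underloaded n t x)) / real n"
  define v where "v = (\<Sum>i\<in>underloaded n t x. dev n t x i) / real n"
  have "drift (bin_energy n) n t x = drift (capped_exp n) n t x - drift (\<lambda>y. y\<^sup>2) n t x / 8"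
    unfolding drift_def bin_energy_def sum_divide_distrib sum_subtractf[symmetric]
    by (intro sum.cong) (auto simp: field_simps)
  moreover have "drift (\<lambda>y. y\<^sup>2) n t x \<le> 1 + 2 * v"
    unfolding drift_square[OF assms(1) n0] v_def by simp
  moreover have "drift (capped_exp n) n t x \<ge> 1 / 4 - 25 / 4 * u + v / 4"
    using drift_capped_exp[OF assms] unfolding u_def v_def by simp
  moreover have "u \<ge> 0" by (simp add: u_def)
  ultimately show ?thesis unfolding u_def[symmetric] by linarith
qed

section \<open>The surplus as a submartingale, and its increments\<close>

text \<open>
  With \<open>A = 2 t - s\<close> acceptances so far, the last two terms are \<open>7 A - t / 8\<close>.
\<close>

definition surplus :: "nat \<Rightarrow> nat \<Rightarrow> state \<Rightarrow> real" where
  "surplus n t = (\<lambda>(x, s). potential (bin_energy n) n t x - 7 * real s + 111 / 8 * real t)"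

lemma expectation_step_surplus:
  assumes "(\<Sum>i\<in>{1..n}. x i) = t" and n: "n \<ge> 8"
  shows "measure_pmf.expectation (mean_thinning_step n t (x, s)) (surplus n (Suc t))
    \<ge> surplus n t (x, s)"
proof -
  have n0: "n > 0" using n by simp
  define u where "u = real (card (underloaded n t x)) / real n"
  have "measure_pmf.expectation (mean_thinning_step n t (x, s)) (surplus n (Suc t)) =
     measure_pmf.expectation (mean_thinning_step n t (x, s))
       (\<lambda>\<omega>. (case \<omega> of (x', s') \<Rightarrow> potential (bin_energy n) n (Suc t) x' - 7 * real s') + 111 / 8 * real (Suc t))"
    by (intro arg_cong[where f = "integral\<^sup>L _"]) (auto simp: surplus_def)
  also have "\<dots> = potential (bin_energy n) n t x - 7 * real s + drift (bin_energy n) n t x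
      - 7 * (2 - u) + 111 / 8 * real (Suc t)"
    by (subst Bochner_Integration.integral_add)
       (simp_all add: n0 expectation_step_potential[OF n0, where c = 7] u_def)
  \<comment> \<open>The terms linear in time and samples change by 111/8 - 7 (2 - u) = 7 u - 1/8,
    which offsets the lower bound on the energy drift.\<close>
  also have "\<dots> = surplus n t (x, s) + (drift (bin_energy n) n t x - (1 / 8 - 7 * u))"
    unfolding surplus_def prod.case of_nat_Suc distrib_left by simp
  finally show ?thesis using drift_bin_energy[OF assms, folded u_def] by simp
qed

lemma surplus_increment:
  assumes "(\<Sum>i\<in>{1..n}. x i) = t" and n: "n > 0" and j: "j \<in> {1..n}" and k: "k = 1 \<or> k = 2"
  shows "\<bar>surplus n (Suc t) (allocate x j, s + k) - surplus n t (x, s)\<bar> \<le> 14 + \<bar>dev n t x j\<bar>"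
proof -
  let ?y = "dev n t x"
  let ?S = "\<Sum>i\<in>{1..n}. capped_exp n (?y i - 1 / n) - capped_exp n (?y i)"
  let ?D = "capped_exp n (?y j + 1 - 1 / n) - capped_exp n (?y j - 1 / n)"
  \<comment> \<open>Here \<open>p\<close> and \<open>q\<close> are the changes of the exponential
    part from the common shift and from the unit jump, \<open>r\<close> is \<open>1 / n\<close>, and
    \<open>c\<close> counts samples. The constants total at most 13 and the coefficient of y is 1/4;
    both are rounded up.\<close>
  have arith: "\<bar>p - r / 8 + (q - (2 * y + 1 - 2 * r) / 8) - 7 * c + 111 / 8\<bar> \<le> 14 + \<bar>y\<bar>"
    if "\<bar>p\<bar> \<le> 3" "\<bar>q\<bar> \<le> 3" "0 < r" "r \<le> 1" "1 \<le> c" "c \<le> 2" for p q r y c :: real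
    using that unfolding abs_le_iff by (simp add: field_simps abs_if split: if_splits)
  have diff_diff_swap: "a - p - (b - q) = a - b - (p - q)" for a b p q :: real by simp
  \<comment> \<open>The linear terms cancel since the deviations sum to zero, so the common shift
    changes the squares by only \<open>1 / n\<close>.\<close>
  have "(\<Sum>i\<in>{1..n}. (?y i - 1 / n)\<^sup>2 - (?y i)\<^sup>2) = (\<Sum>i\<in>{1..n}. (- 2 / n) * ?y i + 1 / n ^ 2)"
    by (intro sum.cong) (auto simp: power2_eq_square algebra_simps)
  also have "\<dots> = 1 / n"
    unfolding sum.distrib sum_distrib_left[symmetric] sum_dev[OF assms(1) n]
    using n by (simp add: power2_eq_square)
  finally have sq: "(\<Sum>i\<in>{1..n}. (?y i - 1 / n)\<^sup>2 - (?y i)\<^sup>2) = 1 / n" .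
  have "(\<Sum>i\<in>{1..n}. bin_energy n (?y i - 1 / n) - bin_energy n (?y i)) =
      ?S - (\<Sum>i\<in>{1..n}. (?y i - 1 / n)\<^sup>2 - (?y i)\<^sup>2) / 8"
    unfolding sum_divide_distrib sum_subtractf[symmetric]
    by (intro sum.cong) (auto simp: bin_energy_def field_simps)
  then have S: "(\<Sum>i\<in>{1..n}. bin_energy n (?y i - 1 / n) - bin_energy n (?y i)) = ?S - 1 / n / 8"
    by (simp only: sq)
  have "(?y j + 1 - 1 / n)\<^sup>2 - (?y j - 1 / n)\<^sup>2 = 2 * ?y j + 1 - 2 / n"
    by (simp add: power2_eq_square algebra_simps)
  then have D: "bin_energy n (?y j + 1 - 1 / n) - bin_energy n (?y j - 1 / n) =
      ?D - (2 * ?y j + 1 - 2 / n) / 8"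
    unfolding bin_energy_def diff_diff_swap diff_divide_distrib[symmetric] by (simp only:)
  have eq: "surplus n (Suc t) (allocate x j, s + k) - surplus n t (x, s) =
      ?S - 1 / n / 8 + (?D - (2 * ?y j + 1 - 2 / n) / 8) - 7 * real k + 111 / 8"
    unfolding surplus_def prod.case potential_allocate[OF j n] S D of_nat_Suc distrib_left by simp
  have "\<bar>capped_exp n (?y i - 1 / n) - capped_exp n (?y i)\<bar> \<le> 3 * (1 / n)" for i
    using capped_exp_lipschitz[OF n, of "?y i - 1 / n" "?y i"] by simp
  then have "\<bar>?S\<bar> \<le> (\<Sum>i\<in>{1..n}. 3 * (1 / n))"
    by (intro order_trans[OF sum_abs] sum_mono)
  then have "\<bar>?S\<bar> \<le> 3" using n by simp
  moreover have "\<bar>?D\<bar> \<le> 3"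
    using capped_exp_lipschitz[OF n, of "?y j + 1 - 1 / n" "?y j - 1 / n"] by simp
  ultimately show ?thesis
    unfolding eq using arith[of ?S ?D "1 / n" "real k" "?y j"] n k by auto
qed

text \<open>The increment bound involves only the receiving bin, so its mean square is governed by
  the average squared deviation.\<close>

lemma expectation_step_surplus_square:
  assumes "(\<Sum>i\<in>{1..n}. x i) = t" and n: "n > 0"
  shows "measure_pmf.expectation (mean_thinning_step n t (x, s))
      (\<lambda>\<omega>. (surplus n (Suc t) \<omega> - surplus n t (x, s))\<^sup>2)
    \<le> 392 + 4 / n * potential (\<lambda>y. y\<^sup>2) n t x"
proof -
  let ?y = "dev n t x"
  have bound: "(surplus n (Suc t) (allocate x j, s + k) - surplus n t (x, s))\<^sup>2 \<le> 392 + 2 * (?y j)\<^sup>2"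
    if "j \<in> {1..n}" "k = 1 \<or> k = 2" for j k
  proof -
    have "(surplus n (Suc t) (allocate x j, s + k) - surplus n t (x, s))\<^sup>2 \<le> (14 + \<bar>?y j\<bar>)\<^sup>2"
      using surplus_increment[OF assms that] by (intro abs_le_square_iff[THEN iffD1]) simp
    \<comment> \<open>This is (a + b)^2 \<le> 2 a^2 + 2 b^2, with 392 = 2 * 14^2.\<close>
    also have "\<dots> \<le> 392 + 2 * (?y j)\<^sup>2"
      using zero_le_power2[of "14 - \<bar>?y j\<bar>"] by (simp add: power2_eq_square algebra_simps)
    finally show ?thesis .
  qed
  have "measure_pmf.expectation (mean_thinning_step n t (x, s))
      (\<lambda>\<omega>. (surplus n (Suc t) \<omega> - surplus n t (x, s))\<^sup>2)
    \<le> (\<Sum>j\<in>{1..n}. weight n t x j * (392 + 2 * (?y j)\<^sup>2)) / n"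
    using bound by (intro expectation_step_le n) blast+
  also have "(\<Sum>j\<in>{1..n}. weight n t x j * (392 + 2 * (?y j)\<^sup>2)) =
      392 * real n + (\<Sum>j\<in>{1..n}. weight n t x j * (2 * (?y j)\<^sup>2))"
    unfolding distrib_left sum.distrib sum_distrib_right[symmetric] sum_weight[OF n] by simp
  also have "\<dots> \<le> 392 * real n + (\<Sum>j\<in>{1..n}. 2 * (2 * (?y j)\<^sup>2))"
    using weight_bounds[OF n] by (intro add_left_mono sum_mono mult_right_mono) auto
  also have "\<dots> / n = 392 + 4 / n * potential (\<lambda>y. y\<^sup>2) n t x"
    using n by (simp add: potential_def sum_distrib_left[symmetric] add_divide_distrib)
  finally show ?thesis using n by (simp add: divide_right_mono)
qed


section \<open>Second moment of the negative part, and the lower tail\<close>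

text \<open>
  Truncating at 0 makes the square convex and nonincreasing, so the upward drift of the
  submartingale only helps and no Doob decomposition is needed.
\<close>

lemma min_0_square_add_le:
  fixes z d :: real
  shows "(min (z + d) 0)\<^sup>2 \<le> (min z 0)\<^sup>2 + 2 * min z 0 * d + d\<^sup>2"
proof (cases "z + d \<ge> 0")
  case True
  then show ?thesis
    using zero_le_power2[of "z + d"] by (auto simp: min_def power2_sum)
next
  case False
  show ?thesis
  proof (cases "z \<le> 0")
    case True
    then show ?thesis using False by (simp add: min_def power2_sum)
  next
    case z: False
    then have "(z + d)\<^sup>2 \<le> d\<^sup>2" using False by (intro abs_le_square_iff[THEN iffD1]) simp
    then show ?thesis using z False by (simp add: min_def)
  qed
qed

lemma expectation_step_min_0_surplus:
  assumes "(\<Sum>i\<in>{1..n}. x i) = t" and n: "n \<ge> 8"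
  shows "measure_pmf.expectation (mean_thinning_step n t (x, s)) (\<lambda>\<omega>. (min (surplus n (Suc t) \<omega>) 0)\<^sup>2)
    \<le> (min (surplus n t (x, s)) 0)\<^sup>2 + (392 + 4 / n * potential (\<lambda>y. y\<^sup>2) n t x)"
proof -
  have n0: "n > 0" using n by simp
  let ?E = "measure_pmf.expectation (mean_thinning_step n t (x, s))"
  let ?z = "surplus n t (x, s)"
  let ?Z = "surplus n (Suc t)"
  have "?E (\<lambda>\<omega>. (min (?Z \<omega>) 0)\<^sup>2) \<le>
      ?E (\<lambda>\<omega>. (min ?z 0)\<^sup>2 + 2 * min ?z 0 * (?Z \<omega> - ?z) + (?Z \<omega> - ?z)\<^sup>2)"
    using min_0_square_add_le[of ?z "?Z \<omega> - ?z" for \<omega>] by (intro integral_mono) (simp_all add: n0)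
  also have "\<dots> = (min ?z 0)\<^sup>2 + 2 * min ?z 0 * (?E ?Z - ?z) + ?E (\<lambda>\<omega>. (?Z \<omega> - ?z)\<^sup>2)"
    by (simp add: n0)
  also have "2 * min ?z 0 * (?E ?Z - ?z) \<le> 0"
    by (rule mult_nonpos_nonneg) (use expectation_step_surplus[OF assms, of s] in \<open>simp_all add: min_def\<close>)
  finally show ?thesis using expectation_step_surplus_square[OF assms(1) n0, of s] by linarith
qed

lemma surplus_0: "surplus n 0 (\<lambda>_. 0, 0) \<ge> 0"
  by (simp add: surplus_def potential_def bin_energy_def dev_def capped_exp_def)

text \<open>The horizon \<open>m\<close> is fixed so that the expected sum of squares, at most
  \<open>t\<close>, has one bound for all rounds; each round then adds the same amount.\<close>

lemma expectation_min_0_surplus: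
  assumes n: "n \<ge> 8" and "t \<le> m"
  shows "measure_pmf.expectation (mean_thinning n t) (\<lambda>\<omega>. (min (surplus n t \<omega>) 0)\<^sup>2)
    \<le> real t * (392 + 4 * real m / n)"
  using \<open>t \<le> m\<close>
proof (induction t)
  case 0
  show ?case using surplus_0[of n] by simp
next
  case (Suc t)
  have n0: "n > 0" using n by simp
  let ?E = "measure_pmf.expectation (mean_thinning n t)"
  have "measure_pmf.expectation (mean_thinning n (Suc t)) (\<lambda>\<omega>. (min (surplus n (Suc t) \<omega>) 0)\<^sup>2)
    \<le> ?E (\<lambda>\<omega>. (min (surplus n t \<omega>) 0)\<^sup>2
        + (392 + 4 / n * (case \<omega> of (x, s) \<Rightarrow> potential (\<lambda>y. y\<^sup>2) n t x)))"
    using expectation_step_min_0_surplus[OF _ n] mean_thinning_invariant[OF _ n0]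
    by (intro expectation_mean_thinning_Suc_le n0) (auto split: prod.splits)
  also have "\<dots> = ?E (\<lambda>\<omega>. (min (surplus n t \<omega>) 0)\<^sup>2)
      + (392 + 4 / n * ?E (\<lambda>(x, s). potential (\<lambda>y. y\<^sup>2) n t x))"
    by (simp add: n0)
  also have "4 / n * ?E (\<lambda>(x, s). potential (\<lambda>y. y\<^sup>2) n t x) \<le> 4 / n * real m"
    using expectation_square_potential_le[OF n0, of t] Suc.prems by (intro mult_left_mono) auto
  finally have "measure_pmf.expectation (mean_thinning n (Suc t)) (\<lambda>\<omega>. (min (surplus n (Suc t) \<omega>) 0)\<^sup>2)
      \<le> real t * (392 + 4 * real m / n) + (392 + 4 / n * real m)"
    using Suc.IH Suc.prems by simp
  also have "\<dots> = real (Suc t) * (392 + 4 * real m / n)"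
    unfolding of_nat_Suc distrib_right by simp
  finally show ?case .
qed

text \<open>Markov's inequality for the squared negative part: its mean is of order m^2 / n once m
  \<ge> n, against a squared threshold of order m^2. The constant is 396 * 32^2.\<close>

lemma surplus_lower_tail:
  assumes n: "n \<ge> 8" and m: "n \<le> m"
  shows "measure_pmf.prob (mean_thinning n m) {\<omega>. surplus n m \<omega> \<le> - (real m / 32)} \<le> 405504 / n"
proof -
  have n0: "n > 0" and m0: "m > 0" using n m by auto
  let ?A = "{\<omega>. surplus n m \<omega> \<le> - (real m / 32)}"
  have "(real m / 32)\<^sup>2 * measure_pmf.prob (mean_thinning n m) ?A =
      measure_pmf.expectation (mean_thinning n m) (\<lambda>\<omega>. (real m / 32)\<^sup>2 * indicator ?A \<omega>)"
    by simp
  also have "\<dots> \<le> measure_pmf.expectation (mean_thinning n m) (\<lambda>\<omega>. (min (surplus n m \<omega>) 0)\<^sup>2)"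
    by (intro integral_mono)
       (auto simp: n0 indicator_def min_def simp flip: abs_le_square_iff)
  also have "\<dots> \<le> real m * (392 + 4 * real m / n)"
    by (rule expectation_min_0_surplus[OF n order_refl])
  also have "\<dots> \<le> real m * (396 * real m / n)"
    using m n0 by (intro mult_left_mono) (auto simp: field_simps)
  also have "\<dots> = (real m / 32)\<^sup>2 * (405504 / n)"
    by (simp add: power2_eq_square)
  finally show ?thesis by (rule mult_left_le_imp_le) (use m0 in simp)
qed

section \<open>From the surplus to the sample efficiency\<close>

lemma sample_efficiency_eq:
  assumes "(x, s) \<in> set_pmf (mean_thinning n m)" "n > 0"
  shows "sample_efficiency n (x, s) = real m / real s"
  using mean_thinning_invariant[OF assms] by (simp add: sample_efficiency_def flip: of_nat_sum)

text \<open>A round uses at most two samples. This sure bound covers the exceptional event when the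
  expectation is estimated.\<close>

lemma sample_efficiency_ge_half:
  assumes "\<omega> \<in> set_pmf (mean_thinning n m)" "n > 0" "m > 0"
  shows "sample_efficiency n \<omega> \<ge> 1 / 2"
proof -
  obtain x s where \<omega>: "\<omega> = (x, s)" by fastforce
  have "m \<le> s" "s \<le> 2 * m" using mean_thinning_invariant[of x s n m] assms \<omega> by auto
  moreover have eff: "sample_efficiency n \<omega> = real m / real s"
    using sample_efficiency_eq[of x s n m] assms \<omega> by simp
  ultimately show ?thesis unfolding eff using assms(3) by (simp add: field_simps)
qed

lemma sample_efficiency_surplus:
  assumes "\<omega> \<in> set_pmf (mean_thinning n m)" "n > 0" "real m \<ge> 96 * real n"
    and "surplus n m \<omega> > - (real m / 32)"
  shows "sample_efficiency n \<omega> \<ge> 1 / 2 + 1 / 500"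
proof -
  obtain x s where \<omega>: "\<omega> = (x, s)" by fastforce
  have "bin_energy n y \<le> 3" for y
    using capped_exp_bounds(2)[OF assms(2), of y] zero_le_power2[of y]
    unfolding bin_energy_def by linarith
  then have "potential (bin_energy n) n m x \<le> (\<Sum>i\<in>{1..n}. 3)"
    unfolding potential_def by (intro sum_mono)
  then have "7 * real s \<le> 3 * real n + 111 / 8 * real m + real m / 32"
    using assms(4) \<omega> by (simp add: surplus_def)
  \<comment> \<open>By m \<ge> 96 n the term 3 n is at most m/32, so s/m is at most (111/8 + 1/16) /
    7 = 2 - 1/112. The efficiency is then at least 112/223, which exceeds 0.502.\<close>
  then have s: "real s \<le> 446 / 224 * real m" using assms(3) by simp
  have "m \<le> s" using mean_thinning_invariant[of x s n m] assms \<omega> by auto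
  moreover have "m > 0" using assms(2,3) by (cases m) auto
  moreover have eff: "sample_efficiency n \<omega> = real m / real s"
    using sample_efficiency_eq[of x s n m] assms \<omega> by simp
  ultimately show ?thesis unfolding eff using s by (simp add: field_simps)
qed

lemma prob_sample_efficiency:
  assumes n: "n \<ge> 8" and m: "real m \<ge> 96 * real n"
  shows "measure_pmf.prob (mean_thinning n m) {\<omega>. sample_efficiency n \<omega> \<ge> 1 / 2 + 1 / 500}
    \<ge> 1 - 405504 / n"
proof -
  have n0: "n > 0" using n by simp
  have nm: "n \<le> m" using m by simp
  let ?P = "measure_pmf.prob (mean_thinning n m)"
  have "1 - 405504 / n \<le> 1 - ?P {\<omega>. surplus n m \<omega> \<le> - (real m / 32)}"
    using surplus_lower_tail[OF n nm] by simp
  also have "\<dots> = ?P (- {\<omega>. surplus n m \<omega> \<le> - (real m / 32)})"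
    using measure_pmf.prob_compl[of "{\<omega>. surplus n m \<omega> \<le> - (real m / 32)}" "mean_thinning n m"]
    by (simp add: Compl_eq_Diff_UNIV)
  also have "\<dots> \<le> ?P {\<omega>. sample_efficiency n \<omega> \<ge> 1 / 2 + 1 / 500}"
    using sample_efficiency_surplus[OF _ n0 m]
    by (intro measure_pmf.finite_measure_mono_AE) (auto simp: AE_measure_pmf_iff)
  finally show ?thesis .
qed

theorem lemma3p7:
  "\<exists>\<rho>::real. \<rho> > 0 \<and>
    (\<forall>\<^sub>F n::nat in sequentially. \<forall>m::nat. real m \<ge> inverse \<rho> * (real n * ln (real n)) \<longrightarrow>
      measure_pmf.expectation (mean_thinning n m) (sample_efficiency n) \<ge> 1/2 + \<rho> \<and>
      measure_pmf.prob (mean_thinning n m) {\<omega>. sample_efficiency n \<omega> \<ge> 1/2 + \<rho>}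
        \<ge> 1 - real n powr (-1/4))"
\<comment> \<open>The witness is half of 1/500, because the expectation bound uses the gain 1/500 on
  an event of probability at least 1/2.\<close>
proof (intro exI[of _ "1 / 1000"] conjI)
  have ev: "\<forall>\<^sub>F n in sequentially. n \<ge> (8::nat)"
    "\<forall>\<^sub>F n in sequentially. ln (real n) \<ge> 1"
    "\<forall>\<^sub>F n in sequentially. 405504 / real n \<le> real n powr (-1/4)"
    "\<forall>\<^sub>F n in sequentially. 405504 / real n \<le> 1 / 2"
    by real_asymp+
  from ev show "\<forall>\<^sub>F n::nat in sequentially. \<forall>m::nat.
      real m \<ge> inverse (1 / 1000) * (real n * ln (real n)) \<longrightarrow>
      measure_pmf.expectation (mean_thinning n m) (sample_efficiency n) \<ge> 1/2 + 1 / 1000 \<and>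
      measure_pmf.prob (mean_thinning n m) {\<omega>. sample_efficiency n \<omega> \<ge> 1/2 + 1 / 1000}
        \<ge> 1 - real n powr (-1/4)"
  proof (eventually_elim, intro allI impI)
    fix n m :: nat
    assume n: "n \<ge> 8" and ln: "ln (real n) \<ge> 1"
      and p: "405504 / real n \<le> real n powr (-1/4)" "405504 / real n \<le> 1 / 2"
      and m: "real m \<ge> inverse (1 / 1000) * (real n * ln (real n))"
    let ?P = "measure_pmf.prob (mean_thinning n m)"
    let ?A = "{\<omega>. sample_efficiency n \<omega> \<ge> 1 / 2 + 1 / 500}"
    \<comment> \<open>Since ln n \<ge> 1, the hypothesis on \<open>m\<close> gives m \<ge> 1000 n,
      more than the required 96 n.\<close>
    have "real n * 1 \<le> real n * ln (real n)" using ln by (intro mult_left_mono) auto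
    with m have m96: "real m \<ge> 96 * real n" by simp
    with n have n0: "n > 0" and m0: "m > 0" by auto
    have A: "?P ?A \<ge> 1 - 405504 / n" by (rule prob_sample_efficiency[OF n m96])
    have "1 / 2 + 1 / 1000 \<le> 1 / 2 + 1 / 500 * ?P ?A" using A p(2) by simp
    also have "\<dots> = measure_pmf.expectation (mean_thinning n m) (\<lambda>\<omega>. 1 / 2 + 1 / 500 * indicator ?A \<omega>)"
      by (simp add: n0)
    \<comment> \<open>Pointwise on the support, the efficiency is at least 1/2 everywhere and at
      least 1/2 + 1/500 on \<open>?A\<close>.\<close>
    also have "\<dots> \<le> measure_pmf.expectation (mean_thinning n m) (sample_efficiency n)"
      using sample_efficiency_ge_half[OF _ n0 m0] n0
      by (intro integral_mono_AE) (auto simp: AE_measure_pmf_iff indicator_def)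
    finally have E: "measure_pmf.expectation (mean_thinning n m) (sample_efficiency n) \<ge> 1/2 + 1 / 1000" .
    have "1 - real n powr (-1/4) \<le> ?P ?A" using A p(1) by linarith
    also have "\<dots> \<le> ?P {\<omega>. sample_efficiency n \<omega> \<ge> 1/2 + 1 / 1000}"
      by (intro measure_pmf.finite_measure_mono) auto
    finally show "measure_pmf.expectation (mean_thinning n m) (sample_efficiency n) \<ge> 1/2 + 1 / 1000 \<and>
      ?P {\<omega>. sample_efficiency n \<omega> \<ge> 1/2 + 1 / 1000} \<ge> 1 - real n powr (-1/4)"
      using E by blast
  qed
qed simp

end
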